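(* For every integer $n\ge1$, $\sigma(n)\le 3n-3$; i.e., for every string of length $n$ the sum of the exponents of all its runs is at most $3n-3$.
   Context: Strings are indexed from 1. An integer $p\ge1$ is a period of $s$ if $s[k]=s[k+p]$ for all $1\le k\le |s|-p$. A run of a string $w$ of length $n$ is a triple $(i,j,p)$ with $1\le i\le j\le n$ such that $p$ is the smallest period of $w[i..j]$, $j-i+1\ge 2p$, ($i=1$ or $w[i-1]\ne w[i+p-1]$), and ($j=n$ or $w[j+1]\ne w[j-p+1]$). Its exponent is $(j-i+1)/p$. $\sigma(n)$ denotes the maximum, over strings of length $n$, of the sum of exponents of all runs of the string. *)

theory Defs
  imports Complex_Main
begin

text \<open>
  Strings are lists over an arbitrary alphabet type. List indexing (\<open>!\<close>) starts at 0, while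
  positions below are counted from 1; every position passed to \<open>letter\<close> is at least 1 in the
  places where it matters.
\<close>

definition letter :: "'a list \<Rightarrow> nat \<Rightarrow> 'a" where
  "letter w k = w ! (k - 1)"

definition factor :: "'a list \<Rightarrow> nat \<Rightarrow> nat \<Rightarrow> 'a list" where
  "factor w i j = take (j - i + 1) (drop (i - 1) w)"

lemma length_factor:
  assumes "1 \<le> i" "i \<le> j" "j \<le> length w"
  shows "length (factor w i j) = j - i + 1"
  using assms by (simp add: factor_def)

lemma letter_factor:
  assumes "1 \<le> i" "i \<le> j" "j \<le> length w" "1 \<le> k" "k \<le> j - i + 1"
  shows "letter (factor w i j) k = letter w (i + k - 1)"
proof -
  have "i - 1 + (k - 1) = i + k - 1 - 1" using assms by linarith
  then show ?thesis using assms by (simp add: factor_def letter_def)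
qed

definition is_period :: "'a list \<Rightarrow> nat \<Rightarrow> bool" where
  "is_period s p \<longleftrightarrow>
     p \<ge> 1 \<and> (\<forall>k. 1 \<le> k \<and> k + p \<le> length s \<longrightarrow> letter s k = letter s (k + p))"

definition smallest_period :: "'a list \<Rightarrow> nat" where
  "smallest_period s = (LEAST p. is_period s p)"

lemma is_period_smallest_period: "is_period s (smallest_period s)"
proof -
  have "is_period s (Suc (length s))" by (simp add: is_period_def)
  then show ?thesis unfolding smallest_period_def by (rule LeastI)
qed

definition is_run :: "'a list \<Rightarrow> nat \<times> nat \<times> nat \<Rightarrow> bool" where
  "is_run w = (\<lambda>(i, j, p).
     1 \<le> i \<and> i \<le> j \<and> j \<le> length w \<and>
     p = smallest_period (factor w i j) \<and>
     j - i + 1 \<ge> 2 * p \<and>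
     (i = 1 \<or> letter w (i - 1) \<noteq> letter w (i + p - 1)) \<and>
     (j = length w \<or> letter w (j + 1) \<noteq> letter w (j - p + 1)))"

definition runs :: "'a list \<Rightarrow> (nat \<times> nat \<times> nat) set" where
  "runs w = {r. is_run w r}"

definition run_exponent :: "nat \<times> nat \<times> nat \<Rightarrow> real" where
  "run_exponent = (\<lambda>(i, j, p). real (j - i + 1) / real p)"

definition sum_of_exponents :: "'a list \<Rightarrow> real" where
  "sum_of_exponents w = (\<Sum>r\<in>runs w. run_exponent r)"

text \<open>
  The maximum over all strings of length \<open>n\<close> is taken over the alphabet \<open>nat\<close>: a string of
  finite length uses finitely many letters, and renaming them injectively does not change its runs.
  The lemma \<open>sigma_is_maximum\<close> shows that this maximum exists for every \<open>n\<close>.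
\<close>

definition sigma :: "nat \<Rightarrow> real" where
  "sigma n = Max {sum_of_exponents w | w :: nat list. length w = n}"

lemma runs_subset:
  "runs w \<subseteq> {1..length w} \<times> {1..length w} \<times> {1..length w}"
proof
  fix r assume "r \<in> runs w"
  then obtain i j p where r: "r = (i, j, p)" and run: "is_run w (i, j, p)"
    by (cases r) (auto simp: runs_def)
  have "p \<ge> 1"
    using run is_period_smallest_period[of "factor w i j"]
    by (auto simp: is_run_def is_period_def)
  with run show "r \<in> {1..length w} \<times> {1..length w} \<times> {1..length w}"
    by (auto simp: r is_run_def)
qed

lemma finite_runs: "finite (runs w)"
  by (rule finite_subset[OF runs_subset]) simp

lemma finite_sums_of_exponents:
  "finite {sum_of_exponents w | w :: 'a list. length w = n}"
proof (rule finite_subset)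
  show "{sum_of_exponents w | w :: 'a list. length w = n}
          \<subseteq> sum run_exponent ` Pow ({1..n} \<times> {1..n} \<times> {1..n})"
    using runs_subset by (force simp: sum_of_exponents_def)
qed simp

lemma sigma_is_maximum:
  "\<exists>w :: nat list. length w = n \<and> sigma n = sum_of_exponents w"
  "length (w :: nat list) = n \<Longrightarrow> sum_of_exponents w \<le> sigma n"
proof -
  have "{sum_of_exponents w | w :: nat list. length w = n} \<noteq> {}"
    using length_replicate[of n "0 :: nat"] by blast
  from Max_in[OF finite_sums_of_exponents this]
  show "\<exists>w :: nat list. length w = n \<and> sigma n = sum_of_exponents w"
    unfolding sigma_def by blast
  show "length (w :: nat list) = n \<Longrightarrow> sum_of_exponents w \<le> sigma n"
    unfolding sigma_def by (rule Max_ge[OF finite_sums_of_exponents]) blast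
qed

end

theory Submission
  imports Defs
begin

text \<open>
  This is the argument of Bannai, I, Inenaga, Nakashima, Takeda and Tsuruta. Code the letters as
  integers and put a sentinel around the word; negating the codes reverses the lexicographic order
  of the suffixes. For a run \<open>(i, j, p)\<close> take the order in which the letter at \<open>j + 1\<close> is smaller
  than the one at \<open>j + 1 - p\<close>, and let \<open>B\<close> be the set of positions \<open>k > i\<close> at which a
  Lyndon word of length \<open>p\<close> inside the run begins. For \<open>k \<in> B\<close> the next smaller suffix after \<open>k\<close>
  starts at \<open>k + p\<close>, so \<open>k\<close> and the order determine the run; a coincidence between the two opposite
  orders forces a period 1, which makes a Lyndon word of length at least 2 begin and end with the
  same letter. Hence the sets \<open>B\<close> are disjoint subsets of \<open>{2..n}\<close>. A run of exponent \<open>e\<close> has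
  \<open>|B| \<ge> max 1 (e - 2)\<close>, so there are at most \<open>n - 1\<close> runs and the exponents sum
  to at most \<open>(n - 1) + 2 (n - 1)\<close>.
\<close>

section \<open>Lyndon words inside a sequence\<close>

text \<open>Strict lexicographic order of infinite suffixes. Suffixes that never differ are
  incomparable, so totality needs a mismatch.\<close>

definition suffix_less :: "(nat \<Rightarrow> int) \<Rightarrow> nat \<Rightarrow> nat \<Rightarrow> bool" where
  "suffix_less v i j \<longleftrightarrow> (\<exists>d. (\<forall>e<d. v (i + e) = v (j + e)) \<and> v (i + d) < v (j + d))"

lemma suffix_lessI:
  assumes "\<And>e. e < d \<Longrightarrow> v (i + e) = v (j + e)" "v (i + d) < v (j + d)"
  shows "suffix_less v i j"
  using assms unfolding suffix_less_def by blast

lemma suffix_less_asym: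
  assumes "suffix_less v i j"
  shows "\<not> suffix_less v j i"
proof
  assume "suffix_less v j i"
  then obtain d' where d': "\<forall>e<d'. v (j + e) = v (i + e)" "v (j + d') < v (i + d')"
    unfolding suffix_less_def by blast
  obtain d where d: "\<forall>e<d. v (i + e) = v (j + e)" "v (i + d) < v (j + d)"
    using assms unfolding suffix_less_def by blast
  show False
    using d d' by (cases d d' rule: linorder_cases) auto
qed

lemma suffix_less_trans:
  assumes "suffix_less v i j" "suffix_less v j k"
  shows "suffix_less v i k"
proof -
  obtain d where d: "\<forall>e<d. v (i + e) = v (j + e)" "v (i + d) < v (j + d)"
    using assms(1) unfolding suffix_less_def by blast
  obtain d' where d': "\<forall>e<d'. v (j + e) = v (k + e)" "v (j + d') < v (k + d')"
    using assms(2) unfolding suffix_less_def by blast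
  show ?thesis
    by (rule suffix_lessI[where d = "min d d'"])
      (use d d' in \<open>cases d d' rule: linorder_cases; auto simp: min_def\<close>)+
qed

lemma suffix_less_total:
  assumes "v (i + t) \<noteq> v (j + t)"
  shows "suffix_less v i j \<or> suffix_less v j i"
proof -
  define d where "d = (LEAST t. v (i + t) \<noteq> v (j + t))"
  have "v (i + d) \<noteq> v (j + d)"
    unfolding d_def using assms by (rule LeastI)
  moreover have "v (i + e) = v (j + e)" if "e < d" for e
    using not_less_Least[of e "\<lambda>t. v (i + t) \<noteq> v (j + t)"] that unfolding d_def by blast
  ultimately show ?thesis
    using suffix_lessI[of d v i j] suffix_lessI[of d v j i] by (metis linorder_neqE)
qed

lemma suffix_less_uminus: "suffix_less (\<lambda>t. - v t) i j \<longleftrightarrow> suffix_less v j i"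
  unfolding suffix_less_def by (metis neg_equal_iff_equal neg_less_iff_less)

text \<open>The Lyndon property of the \<open>p\<close> letters from \<open>k\<close>. Lyndon words
  have no borders, so the mismatch with each proper suffix can be required inside the word; what
  follows the word is then irrelevant.\<close>

definition lyndon_at :: "(nat \<Rightarrow> int) \<Rightarrow> nat \<Rightarrow> nat \<Rightarrow> bool" where
  "lyndon_at v k p \<longleftrightarrow> (\<forall>m. 0 < m \<and> m < p \<longrightarrow>
     (\<exists>d. m + d < p \<and> (\<forall>e<d. v (k + e) = v (k + m + e)) \<and> v (k + d) < v (k + m + d)))"

lemma lyndon_at_suffix_less:
  assumes "lyndon_at v k p" "0 < m" "m < p"
  shows "suffix_less v k (k + m)"
  using assms unfolding lyndon_at_def suffix_less_def by blast

lemma lyndon_at_first_less_last: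
  assumes "lyndon_at v k p" "2 \<le> p"
  shows "v k < v (k + p - 1)"
proof -
  have "0 < p - 1 \<and> p - 1 < p"
    using assms(2) by simp
  then obtain d where "p - 1 + d < p" "v (k + d) < v (k + (p - 1) + d)"
    using assms(1) unfolding lyndon_at_def by blast
  moreover from this have "d = 0"
    by linarith
  ultimately show ?thesis
    using assms(2) by simp
qed

lemma lyndon_at_cong:
  assumes "lyndon_at u k' p" "\<And>t. t < p \<Longrightarrow> v (k + t) = u (k' + t)"
  shows "lyndon_at v k p"
  unfolding lyndon_at_def
proof (intro allI impI)
  fix m assume m: "0 < m \<and> m < p"
  then obtain d where d: "m + d < p" "\<forall>e<d. u (k' + e) = u (k' + m + e)"
      "u (k' + d) < u (k' + m + d)"
    using assms(1) unfolding lyndon_at_def by blast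
  have "v (k + t) = u (k' + t)" "v (k + m + t) = u (k' + m + t)" if "t \<le> d" for t
    using assms(2)[of t] assms(2)[of "m + t"] d(1) that by (simp_all add: add.assoc)
  then show "\<exists>d. m + d < p \<and> (\<forall>e<d. v (k + e) = v (k + m + e)) \<and> v (k + d) < v (k + m + d)"
    using d by (intro exI[of _ d]) simp
qed

lemma periodic_mult:
  fixes u :: "nat \<Rightarrow> int"
  assumes "\<And>t. u (t + p) = u t"
  shows "u (t + c * p) = u t"
proof (induction c)
  case (Suc c)
  show ?case
    using assms[of "t + c * p"] Suc by (simp add: algebra_simps)
qed simp

text \<open>The least rotation works; primitivity makes it differ from the others. Starts range over
  \<open>1..p\<close>, not from 0, so that the roots built from it begin strictly after the start of
  a run.\<close>

lemma ex_lyndon_rotation: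
  fixes u :: "nat \<Rightarrow> int"
  assumes p: "1 \<le> p" and per: "\<And>t. u (t + p) = u t"
    and prim: "\<And>q. 0 < q \<Longrightarrow> q < p \<Longrightarrow> \<exists>t. u (t + q) \<noteq> u t"
  shows "\<exists>k. 1 \<le> k \<and> k \<le> p \<and> lyndon_at u k p"
proof -
  note perm = periodic_mult[of u, OF per]
  have "\<exists>k\<in>{1..p}. \<forall>x\<in>{1..p}. x \<noteq> k \<longrightarrow> \<not> suffix_less u x k"
    using p
    by (intro Finite_Set.bex_min_element)
      (auto intro!: asymp_onI transp_onI dest: suffix_less_asym intro: suffix_less_trans)
  then obtain k where k: "1 \<le> k" "k \<le> p"
    and min: "\<And>x. 1 \<le> x \<Longrightarrow> x \<le> p \<Longrightarrow> \<not> suffix_less u x k"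
    using suffix_less_asym by (metis atLeastAtMost_iff)
  have "u (x + p + e) = u (x + e)" for x e
    using per[of "x + e"] by (simp add: add_ac)
  then have shift: "suffix_less u (x + p) y = suffix_less u x y" for x y
    unfolding suffix_less_def by simp
  \<comment> \<open>The starts \<open>k + m\<close> and \<open>k + p - m\<close> used below can
    exceed \<open>p\<close>, but not \<open>2 * p\<close>.\<close>
  have min': "\<not> suffix_less u x k" if "1 \<le> x" "x \<le> 2 * p" for x
  proof (cases "x \<le> p")
    case False
    then show ?thesis
      using min[of "x - p"] shift[of "x - p" k] that by simp
  qed (use min that in simp)
  have "lyndon_at u k p"
    unfolding lyndon_at_def
  proof (intro allI impI)
    fix m assume m: "0 < m \<and> m < p"
    then obtain t where t: "u (t + m) \<noteq> u t"
      using prim by blast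
    \<comment> \<open>The mismatch at \<open>t\<close> may precede \<open>k\<close>;
      \<open>k\<close> further periods move it to \<open>k\<close> or later.\<close>
    have "k * p \<ge> k"
      using p by simp
    then have "k + (t + k * p - k) = t + k * p" "k + m + (t + k * p - k) = t + m + k * p"
      by linarith+
    then have "u (k + (t + k * p - k)) \<noteq> u (k + m + (t + k * p - k))"
      using t perm by metis
    then have "suffix_less u k (k + m)"
      using suffix_less_total[of u k _ "k + m"] min'[of "k + m"] m k by auto
    then obtain d where d: "\<forall>e<d. u (k + e) = u (k + m + e)" "u (k + d) < u (k + m + d)"
      unfolding suffix_less_def by blast
    have "m + d < p"
    proof (rule ccontr)
      assume neg: "\<not> m + d < p"
      \<comment> \<open>A border of the rotation: deleting its \<open>p - m\<close> letters leaves a rotation below the minimal one.\<close>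
      have "u (k + p - m + e) = u (k + e)" if "e < d - (p - m)" for e
      proof -
        have "p - m + e < d"
          using that neg by linarith
        then have "u (k + (p - m + e)) = u (k + m + (p - m + e))"
          using d(1) by blast
        moreover have "k + m + (p - m + e) = k + e + p" "k + (p - m + e) = k + p - m + e"
          using m by linarith+
        ultimately show ?thesis
          using per by metis
      qed
      moreover have "k + p - m + (d - (p - m)) = k + d" "k + m + d = k + (d - (p - m)) + p"
        using m neg by linarith+
      then have "u (k + p - m + (d - (p - m))) < u (k + (d - (p - m)))"
        using d(2) per by metis
      ultimately have "suffix_less u (k + p - m) k"
        by (rule suffix_lessI)
      then show False
        using min'[of "k + p - m"] m k by linarith
    qed
    then show "\<exists>d. m + d < p \<and> (\<forall>e<d. u (k + e) = u (k + m + e)) \<and> u (k + d) < u (k + m + d)"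
      using d by blast
  qed
  then show ?thesis
    using k by blast
qed

section \<open>Maximal repetitions and their Lyndon roots\<close>

text \<open>The ends of the word need no exception: sentinels supply the two mismatches
  there.\<close>

definition max_rep :: "(nat \<Rightarrow> int) \<Rightarrow> nat \<Rightarrow> nat \<Rightarrow> nat \<Rightarrow> bool" where
  "max_rep v i j p \<longleftrightarrow>
     1 \<le> i \<and> 1 \<le> p \<and> i + 2 * p \<le> j + 1 \<and>
     (\<forall>t. i \<le> t \<and> t + p \<le> j \<longrightarrow> v t = v (t + p)) \<and>
     (\<forall>q. 0 < q \<and> q < p \<longrightarrow> (\<exists>t. i \<le> t \<and> t + q \<le> j \<and> v t \<noteq> v (t + q))) \<and>
     v (i - 1) \<noteq> v (i - 1 + p) \<and>
     v (j + 1) \<noteq> v (j + 1 - p)"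

text \<open>Of the two opposite orders, the one in which the letter breaking the period on the right
  is the smaller.\<close>

definition orient :: "(nat \<Rightarrow> int) \<Rightarrow> nat \<Rightarrow> nat \<Rightarrow> nat \<Rightarrow> int" where
  "orient v j p = (if v (j + 1) < v (j + 1 - p) then v else (\<lambda>t. - v t))"

text \<open>Requiring \<open>i < k\<close> keeps \<open>k - 1\<close> inside the repetition, which
  settles the clash with period 1.\<close>

definition root_starts :: "(nat \<Rightarrow> int) \<Rightarrow> nat \<times> nat \<times> nat \<Rightarrow> nat set" where
  "root_starts v = (\<lambda>(i, j, p). {k. i < k \<and> k + p \<le> j + 1 \<and> lyndon_at (orient v j p) k p})"

lemma orient_eq_iff: "orient v j p x = orient v j p y \<longleftrightarrow> v x = v y"
  by (simp add: orient_def)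

text \<open>The repetition is a window of a periodic sequence \<open>u\<close>, whose Lyndon
  rotation recurs every \<open>p\<close> positions.\<close>

lemma card_root_starts:
  assumes "max_rep v i j p"
  shows "(j + 1 - i) div p - 1 \<le> card (root_starts v (i, j, p))"
proof -
  define L where "L = j + 1 - i"
  define u where "u t = orient v j p (i + t mod p)" for t
  have p: "1 \<le> p" and i: "1 \<le> i" and len: "i + 2 * p \<le> j + 1"
    and per: "\<And>t. i \<le> t \<Longrightarrow> t + p \<le> j \<Longrightarrow> v t = v (t + p)"
    and prim: "\<And>q. 0 < q \<Longrightarrow> q < p \<Longrightarrow> \<exists>t. i \<le> t \<and> t + q \<le> j \<and> v t \<noteq> v (t + q)"
    using assms unfolding max_rep_def by auto
  have vu: "orient v j p (i + t) = u t" if "i + t \<le> j" for t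
    using that
  proof (induction t rule: less_induct)
    case (less t)
    show ?case
    proof (cases "t < p")
      case False
      then have "orient v j p (i + (t - p)) = u (t - p)"
        using less.prems p by (intro less.IH) auto
      moreover have "v (i + (t - p)) = v (i + t)"
        using per[of "i + (t - p)"] False less.prems by simp
      ultimately show ?thesis
        using False by (metis le_mod_geq not_less orient_eq_iff u_def)
    qed (simp add: u_def)
  qed
  have "\<exists>k. 1 \<le> k \<and> k \<le> p \<and> lyndon_at u k p"
  proof (rule ex_lyndon_rotation)
    fix q assume "0 < q" "q < p"
    then obtain t where t: "i \<le> t" "t + q \<le> j" "v t \<noteq> v (t + q)"
      using prim by blast
    then have "orient v j p t = u (t - i)" "orient v j p (t + q) = u (t - i + q)"
      using vu[of "t - i"] vu[of "t - i + q"] by simp_all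
    then have "u (t - i + q) \<noteq> u (t - i)"
      using t(3) orient_eq_iff by metis
    then show "\<exists>t. u (t + q) \<noteq> u t" ..
  qed (use p in \<open>auto simp: u_def\<close>)
  then obtain k where k: "1 \<le> k" "k \<le> p" and lyn: "lyndon_at u k p"
    by blast
  \<comment> \<open>As \<open>k \<le> p\<close>, copy \<open>c\<close> ends within the first
    \<open>(c + 2) * p\<close> positions of the repetition.\<close>
  let ?f = "\<lambda>c. i + k + c * p"
  have "?f ` {..<L div p - 1} \<subseteq> root_starts v (i, j, p)"
  proof (rule image_subsetI)
    fix c assume "c \<in> {..<L div p - 1}"
    then have "(c + 2) * p \<le> L div p * p"
      by (intro mult_right_mono) auto
    also have "\<dots> \<le> L"
      by simp
    finally have le: "?f c + p \<le> j + 1"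
      using k len unfolding L_def by (simp add: algebra_simps)
    have "orient v j p (?f c + t) = u (k + t)" if "t < p" for t
    proof -
      have "orient v j p (?f c + t) = u (k + t + c * p)"
        using vu[of "k + t + c * p"] le that by (simp add: algebra_simps)
      then show ?thesis
        by (simp add: u_def)
    qed
    then have "lyndon_at (orient v j p) (?f c) p"
      by (rule lyndon_at_cong[OF lyn])
    then show "?f c \<in> root_starts v (i, j, p)"
      using le k by (simp add: root_starts_def)
  qed
  moreover have "inj_on ?f {..<L div p - 1}"
    using p by (auto intro: inj_onI)
  moreover have "finite (root_starts v (i, j, p))"
    by (rule finite_subset[of _ "{..j + 1}"]) (auto simp: root_starts_def)
  ultimately have "card {..<L div p - 1} \<le> card (root_starts v (i, j, p))"
    by (metis card_image card_mono)
  then show ?thesis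
    by (simp add: L_def)
qed

section \<open>Disjointness of the sets of root starts\<close>

lemma max_rep_start_le:
  assumes "max_rep v i j p" "max_rep v i' j' p"
    and "i < k" "i' < k" "k + p \<le> j + 1" "k + p \<le> j' + 1"
  shows "i' \<le> i"
proof (rule ccontr)
  assume "\<not> i' \<le> i"
  \<comment> \<open>The first repetition would extend the period of the second to
    \<open>i' - 1\<close>, against left maximality.\<close>
  then have "i \<le> i' - 1" "i' - 1 + p \<le> j"
    using assms by auto
  then show False
    using assms(1,2) unfolding max_rep_def by blast
qed

lemma max_rep_end_le:
  assumes "max_rep v i j p" "max_rep v i' j' p"
    and "i < k" "i' < k" "k + p \<le> j + 1" "k + p \<le> j' + 1"
  shows "j' \<le> j"
proof (rule ccontr)
  assume "\<not> j' \<le> j"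
  then have "i' \<le> j + 1 - p" "j + 1 - p + p \<le> j'" "j + 1 - p + p = j + 1"
    using assms by auto
  then show False
    using assms(1,2) unfolding max_rep_def by metis
qed

text \<open>By periodicity the suffixes agree until the one at \<open>k + p\<close> reaches
  \<open>j + 1\<close>, where \<open>orient\<close> has fixed the outcome.\<close>

lemma suffix_less_shift_period:
  assumes "max_rep v i j p" "i < k" "k + p \<le> j + 1"
  shows "suffix_less (orient v j p) (k + p) k"
proof (rule suffix_lessI[where d = "j + 1 - p - k"])
  have per: "\<And>t. i \<le> t \<Longrightarrow> t + p \<le> j \<Longrightarrow> v t = v (t + p)" and ne: "v (j + 1) \<noteq> v (j + 1 - p)"
    using assms(1) unfolding max_rep_def by auto
  show "orient v j p (k + p + e) = orient v j p (k + e)" if "e < j + 1 - p - k" for e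
    using per[of "k + e"] that assms(2) by (simp add: orient_eq_iff add_ac)
  have "k + p + (j + 1 - p - k) = j + 1" "k + (j + 1 - p - k) = j + 1 - p"
    using assms by auto
  then show "orient v j p (k + p + (j + 1 - p - k)) < orient v j p (k + (j + 1 - p - k))"
    using ne by (auto simp: orient_def)
qed

text \<open>If \<open>p < p'\<close>, the Lyndon word of length \<open>p'\<close> puts suffix
  \<open>k\<close> below suffix \<open>k + p\<close>, but shifting by the period \<open>p\<close>
  gives a smaller suffix.\<close>

lemma root_period_le:
  assumes "max_rep v i j p" "max_rep v i' j' p'"
    and "k \<in> root_starts v (i, j, p)" "k \<in> root_starts v (i', j', p')"
    and "orient v j p = orient v j' p'"
  shows "p' \<le> p"
proof (rule ccontr)
  assume "\<not> p' \<le> p"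
  then have "suffix_less (orient v j p) k (k + p)"
    using lyndon_at_suffix_less[of "orient v j' p'" k p' p] assms
    by (auto simp: root_starts_def max_rep_def)
  moreover have "suffix_less (orient v j p) (k + p) k"
    using suffix_less_shift_period assms(1,3) by (auto simp: root_starts_def)
  ultimately show False
    using suffix_less_asym by blast
qed

text \<open>Both repetitions contain \<open>k - 1\<close>, so the letters at \<open>k\<close> and
  \<open>k + p' - 1\<close> both equal the one there. In neither order can a Lyndon word of length
  at least 2 begin and end alike.\<close>

lemma root_period_one:
  assumes "max_rep v i j 1" "max_rep v i' j' p'"
    and "k \<in> root_starts v (i, j, 1)" "k \<in> root_starts v (i', j', p')"
  shows "p' = 1"
proof (rule ccontr)
  assume "p' \<noteq> 1"
  then have "2 \<le> p'"
    using assms(2) by (auto simp: max_rep_def)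
  then have "orient v j' p' k < orient v j' p' (k + p' - 1)"
    using lyndon_at_first_less_last assms(4) by (auto simp: root_starts_def)
  moreover have "i \<le> k - 1" "k - 1 + 1 = k" "k \<le> j" "i' \<le> k - 1" "k - 1 + p' = k + p' - 1"
      "k + p' - 1 \<le> j'"
    using assms(3,4) by (auto simp: root_starts_def)
  then have "v (k - 1) = v k" "v (k - 1) = v (k + p' - 1)"
    using assms(1,2) unfolding max_rep_def by metis+
  ultimately show False
    by (metis orient_eq_iff less_irrefl)
qed

lemma root_period_eq:
  assumes "max_rep v i j p" "max_rep v i' j' p'"
    and "k \<in> root_starts v (i, j, p)" "k \<in> root_starts v (i', j', p')"
  shows "p = p'"
proof (cases "orient v j p = orient v j' p'")
  case True
  then show ?thesis
    using root_period_le assms by (metis le_antisym)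
next
  case False
  \<comment> \<open>Otherwise suffix \<open>k\<close> would precede suffix \<open>k + 1\<close> both
    in an order and in its reverse.\<close>
  have "p = 1 \<or> p' = 1"
  proof (rule ccontr)
    assume "\<not> (p = 1 \<or> p' = 1)"
    then have "1 < p" "1 < p'"
      using assms(1,2) by (auto simp: max_rep_def)
    then have "suffix_less (orient v j p) k (k + 1)" "suffix_less (orient v j' p') k (k + 1)"
      using lyndon_at_suffix_less[where m = 1] assms(3,4) by (auto simp: root_starts_def)
    then show False
      using False suffix_less_asym by (auto simp: orient_def suffix_less_uminus split: if_splits)
  qed
  then show ?thesis
    using root_period_one assms by metis
qed

lemma root_starts_inj:
  assumes "max_rep v i j p" "max_rep v i' j' p'"
    and "k \<in> root_starts v (i, j, p)" "k \<in> root_starts v (i', j', p')"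
  shows "(i, j, p) = (i', j', p')"
proof -
  have "p = p'"
    using root_period_eq assms by blast
  moreover have "i < k" "i' < k" "k + p \<le> j + 1" "k + p' \<le> j' + 1"
    using assms(3,4) by (auto simp: root_starts_def)
  ultimately show ?thesis
    using assms(1,2) max_rep_start_le max_rep_end_le by (metis le_antisym)
qed

section \<open>Runs of a word\<close>

text \<open>Codes of letters are nonnegative, so the sentinel -1 differs from all of them.\<close>

definition encode :: "('a \<Rightarrow> nat) \<Rightarrow> 'a list \<Rightarrow> nat \<Rightarrow> int" where
  "encode f w t = (if 1 \<le> t \<and> t \<le> length w then int (f (letter w t)) else - 1)"

lemma encode_eq_iff:
  assumes "inj_on f (set w)" "1 \<le> s" "s \<le> length w" "1 \<le> t" "t \<le> length w"
  shows "encode f w s = encode f w t \<longleftrightarrow> letter w s = letter w t"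
proof -
  have "letter w s \<in> set w" "letter w t \<in> set w"
    using assms by (simp_all add: letter_def)
  then show ?thesis
    using assms by (auto simp: encode_def inj_on_eq_iff)
qed

lemma is_period_factor_iff:
  assumes "1 \<le> i" "i \<le> j" "j \<le> length w"
  shows "is_period (factor w i j) q \<longleftrightarrow>
    1 \<le> q \<and> (\<forall>t. i \<le> t \<and> t + q \<le> j \<longrightarrow> letter w t = letter w (t + q))"
    (is "_ \<longleftrightarrow> ?R")
proof
  assume per: "is_period (factor w i j) q"
  have "letter w t = letter w (t + q)" if "i \<le> t" "t + q \<le> j" for t
  proof -
    have "letter (factor w i j) (t - i + 1) = letter (factor w i j) (t - i + 1 + q)"
      using per that assms by (simp add: is_period_def length_factor)
    then show ?thesis
      using that assms by (simp add: letter_factor)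
  qed
  then show ?R
    using per by (simp add: is_period_def)
next
  assume R: ?R
  have "letter (factor w i j) k = letter (factor w i j) (k + q)"
    if "1 \<le> k" "k + q \<le> length (factor w i j)" for k
  proof -
    have "i \<le> i + k - 1" "i + k - 1 + q \<le> j" "i + k - 1 + q = i + (k + q) - 1"
      using that assms by (simp_all add: length_factor)
    then have "letter w (i + k - 1) = letter w (i + (k + q) - 1)"
      using R by metis
    then show ?thesis
      using that assms by (simp add: letter_factor length_factor)
  qed
  then show "is_period (factor w i j) q"
    using R by (simp add: is_period_def)
qed

lemma run_max_rep:
  assumes inj: "inj_on f (set w)" and run: "(i, j, p) \<in> runs w"
  shows "max_rep (encode f w) i j p"
proof -
  have ij: "1 \<le> i" "i \<le> j" "j \<le> length w" and p: "p = smallest_period (factor w i j)"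
    and len: "j - i + 1 \<ge> 2 * p"
    and left: "i = 1 \<or> letter w (i - 1) \<noteq> letter w (i + p - 1)"
    and right: "j = length w \<or> letter w (j + 1) \<noteq> letter w (j - p + 1)"
    using run by (auto simp: runs_def is_run_def)
  have eq: "encode f w t = encode f w (t + q) \<longleftrightarrow> letter w t = letter w (t + q)"
    if "i \<le> t" "t + q \<le> j" for t q
    using that ij by (intro encode_eq_iff[OF inj]) auto
  have per: "is_period (factor w i j) p"
    unfolding p by (rule is_period_smallest_period)
  then have p1: "1 \<le> p" and per': "\<And>t. i \<le> t \<Longrightarrow> t + p \<le> j \<Longrightarrow> letter w t = letter w (t + p)"
    using is_period_factor_iff[OF ij] by auto
  have "\<exists>t. i \<le> t \<and> t + q \<le> j \<and> encode f w t \<noteq> encode f w (t + q)" if "0 < q" "q < p" for q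
  proof -
    have "\<not> is_period (factor w i j) q"
      using that not_less_Least unfolding p smallest_period_def by blast
    then show ?thesis
      using is_period_factor_iff[OF ij] that eq by (metis One_nat_def Suc_leI)
  qed
  moreover have "encode f w (i - 1) \<noteq> encode f w (i - 1 + p)"
  proof (cases "i = 1")
    case True
    \<comment> \<open>Position \<open>i - 1 = 0\<close> carries the sentinel, position
      \<open>p\<close> a letter.\<close>
    then show ?thesis
      using p1 ij len by (simp add: encode_def)
  next
    case False
    then show ?thesis
      using left encode_eq_iff[OF inj, of "i - 1" "i - 1 + p"] ij len by simp
  qed
  moreover have "encode f w (j + 1) \<noteq> encode f w (j + 1 - p)"
  proof (cases "j = length w")
    case True
    have "1 \<le> j + 1 - p" "j + 1 - p \<le> j"
      using p1 ij len by linarith+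
    then show ?thesis
      using True by (simp add: encode_def)
  next
    case False
    then show ?thesis
      using right encode_eq_iff[OF inj, of "j + 1" "j + 1 - p"] ij len p1
      by (simp add: Suc_diff_le)
  qed
  ultimately show ?thesis
    using ij p1 len per' eq unfolding max_rep_def by auto
qed

section \<open>Counting root starts\<close>

lemma sum_of_exponents_le:
  fixes w :: "'a list"
  assumes "1 \<le> length w"
  shows "sum_of_exponents w \<le> 3 * real (length w) - 3"
proof -
  obtain f :: "'a \<Rightarrow> nat" where inj: "inj_on f (set w)"
    using finite_imp_inj_to_nat_seg[OF finite_set[of w]] by blast
  define B where "B = root_starts (encode f w)"
  \<comment> \<open>Position 1 is excluded by \<open>1 \<le> i < k\<close>; this gives
    \<open>n - 1\<close> instead of \<open>n\<close>.\<close>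
  have sub: "B r \<subseteq> {2..length w}" if "r \<in> runs w" for r
    using that runs_subset[of w] run_max_rep[OF inj]
    by (cases r) (fastforce simp: B_def root_starts_def max_rep_def)
  have fin: "finite (B r)" if "r \<in> runs w" for r
    using sub[OF that] by (rule finite_subset) simp
  have disj: "B r \<inter> B r' = {}" if "r \<in> runs w" "r' \<in> runs w" "r \<noteq> r'" for r r'
    using that root_starts_inj run_max_rep[OF inj] unfolding B_def
    by (cases r; cases r') blast
  have bounds: "1 \<le> card (B r) \<and> run_exponent r \<le> real (card (B r)) + 2" if "r \<in> runs w" for r
  proof -
    obtain i j p where r: "r = (i, j, p)"
      by (cases r)
    define L where "L = j + 1 - i"
    have rep: "max_rep (encode f w) i j p"
      using run_max_rep[OF inj] that r by blast
    then have p: "1 \<le> p" and L: "2 * p \<le> L" and Lij: "j - i + 1 = L"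
      by (auto simp: max_rep_def L_def)
    have card: "L div p - 1 \<le> card (B r)"
      using card_root_starts[OF rep] by (simp add: B_def r L_def)
    \<comment> \<open>With \<open>q = L div p\<close> there are at least
      \<open>q - 1 \<ge> 1\<close> root starts, and the exponent is at most
      \<open>q + 1\<close>.\<close>
    have "2 \<le> L div p"
      using L p by (simp add: less_eq_div_iff_mult_less_eq)
    moreover have "L \<le> (L div p + 1) * p"
      using dividend_less_times_div[of p L] p by (simp add: algebra_simps)
    then have "real L \<le> real ((L div p + 1) * p)"
      by (rule of_nat_mono)
    then have "real L / real p \<le> real (L div p + 1)"
      using p by (simp add: field_simps)
    then have "run_exponent r \<le> real (L div p + 1)"
      by (simp add: r run_exponent_def flip: Lij)
    ultimately show ?thesis
      using card by linarith
  qed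
  have "(\<Sum>r\<in>runs w. card (B r)) = card (\<Union>r\<in>runs w. B r)"
    using finite_runs fin disj by (intro card_UN_disjoint[symmetric]) auto
  also have "\<dots> \<le> card {2..length w}"
    using sub by (intro card_mono) auto
  finally have total: "(\<Sum>r\<in>runs w. card (B r)) \<le> length w - 1"
    by simp
  have "card (runs w) \<le> (\<Sum>r\<in>runs w. card (B r))"
    using sum_mono[of "runs w" "\<lambda>_. 1" "\<lambda>r. card (B r)"] bounds by simp
  then have runs: "card (runs w) \<le> length w - 1"
    using total by simp
  have "sum_of_exponents w \<le> (\<Sum>r\<in>runs w. real (card (B r)) + 2)"
    unfolding sum_of_exponents_def using bounds by (intro sum_mono) blast
  also have "\<dots> = real (\<Sum>r\<in>runs w. card (B r)) + 2 * real (card (runs w))"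
    by (simp add: sum.distrib)
  also have "\<dots> \<le> 3 * real (length w - 1)"
    using total runs by linarith
  \<comment> \<open>The subtraction in \<open>length w - 1\<close> is truncated, so the word must be
    nonempty here.\<close>
  finally show ?thesis
    using assms by simp
qed

theorem theorem2:
  fixes n :: nat
  assumes "n \<ge> 1"
  shows "sigma n \<le> 3 * real n - 3 \<and>
         (\<forall>w :: 'a list. length w = n \<longrightarrow> sum_of_exponents w \<le> 3 * real n - 3)"
proof
  obtain w :: "nat list" where "length w = n" "sigma n = sum_of_exponents w"
    using sigma_is_maximum(1) by blast
  then show "sigma n \<le> 3 * real n - 3"
    using sum_of_exponents_le[of w] assms by simp
  show "\<forall>w :: 'a list. length w = n \<longrightarrow> sum_of_exponents w \<le> 3 * real n - 3"
    using sum_of_exponents_le assms by blast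
qed

end
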